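(* If $G$ is a graph of order $n$, then $$\frac{n}{\rho^{\rm o}(G)}\leq \chi_{i}(G)\leq n-\rho^{\rm o}(G)+1,$$ and the bounds are sharp (that is, each of the two bounds is attained with equality by some graph).
   Context: All graphs are finite and simple. The order of a graph is its number of vertices. An injective $k$-coloring function of a graph $G$ is a function $f:V(G)\to\{1,\dots,k\}$ such that no vertex $v$ is adjacent to two distinct vertices $u$ and $w$ with $f(u)=f(w)$ (adjacent vertices may receive the same color). The injective chromatic number $\chi_i(G)$ is the minimum $k$ for which $G$ admits an injective $k$-coloring function. An open packing in $G$ is a set $B\subseteq V(G)$ such that $N_G(u)\cap N_G(v)=\emptyset$ for any two distinct $u,v\in B$, where $N_G(\cdot)$ denotes the open neighborhood. The open packing number $\rho^{\rm o}(G)$ is the maximum cardinality of an open packing in $G$. *)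

theory Defs
  imports Complex_Main "Graph_Theory.Pair_Digraph"
begin

text \<open>
  A finite simple graph is a \<^locale>\<open>pair_graph\<close>: a finite, loop-free, symmetric digraph without
  parallel arcs, where \<open>(u, v) \<in> parcs G\<close> expresses adjacency of \<open>u\<close> and \<open>v\<close>.
  The graph with no vertices is not excluded by \<^locale>\<open>pair_graph\<close>.
\<close>

definition order_of :: "'a pair_pre_digraph \<Rightarrow> nat" where
  "order_of G = card (pverts G)"

definition open_nbhd :: "'a pair_pre_digraph \<Rightarrow> 'a \<Rightarrow> 'a set" where
  "open_nbhd G v = {u \<in> pverts G. (v, u) \<in> parcs G}"

text \<open>Adjacent vertices may receive the same color.\<close>

definition injective_coloring :: "'a pair_pre_digraph \<Rightarrow> nat \<Rightarrow> ('a \<Rightarrow> nat) \<Rightarrow> bool" where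
  "injective_coloring G k f \<longleftrightarrow>
     (\<forall>v \<in> pverts G. f v \<in> {1..k}) \<and>
     \<not> (\<exists>v \<in> pverts G. \<exists>u \<in> pverts G. \<exists>w \<in> pverts G.
          u \<noteq> w \<and> (v, u) \<in> parcs G \<and> (v, w) \<in> parcs G \<and> f u = f w)"

definition injective_chromatic_number :: "'a pair_pre_digraph \<Rightarrow> nat" where
  "injective_chromatic_number G = (LEAST k. \<exists>f. injective_coloring G k f)"

definition open_packing :: "'a pair_pre_digraph \<Rightarrow> 'a set \<Rightarrow> bool" where
  "open_packing G B \<longleftrightarrow>
     B \<subseteq> pverts G \<and> (\<forall>u \<in> B. \<forall>v \<in> B. u \<noteq> v \<longrightarrow> open_nbhd G u \<inter> open_nbhd G v = {})"

definition open_packing_number :: "'a pair_pre_digraph \<Rightarrow> nat" where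
  "open_packing_number G = Max (card ` {B. open_packing G B})"

end

theory Submission
  imports Defs
begin

text \<open>
  The color classes of an injective coloring are open packings, so a coloring with \<open>\<chi>\<close> colors
  covers the vertices by \<open>\<chi>\<close> sets of size at most \<open>\<rho>\<close>. Conversely, giving one color to
  a maximum open packing and a private color to every other vertex is an injective coloring.
  When \<open>\<rho> = 1\<close>, as in the triangle, the two bounds coincide.
\<close>

text \<open>\<open>Max\<close> is meaningful only on a finite nonempty set; this lemma and
  \<open>open_packing_empty\<close> provide both for \<open>open_packing_number\<close>.\<close>

lemma finite_open_packings:
  assumes "finite (pverts G)"
  shows "finite {B. open_packing G B}"
  by (rule finite_subset[of _ "Pow (pverts G)"]) (auto simp: open_packing_def assms)

lemma open_packing_empty: "open_packing G {}"
  by (simp add: open_packing_def)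

lemma card_le_open_packing_number:
  assumes "finite (pverts G)" and "open_packing G B"
  shows "card B \<le> open_packing_number G"
  unfolding open_packing_number_def
  using finite_open_packings[OF assms(1)] assms(2) by (intro Max_ge) auto

lemma open_packing_number_attained:
  assumes "finite (pverts G)"
  obtains B where "open_packing G B" and "card B = open_packing_number G"
proof -
  have "open_packing_number G \<in> card ` {B. open_packing G B}"
    unfolding open_packing_number_def
    using finite_open_packings[OF assms] open_packing_empty by (intro Max_in) auto
  with that show thesis by auto
qed

lemma injective_chromatic_number_le:
  "injective_coloring G k f \<Longrightarrow> injective_chromatic_number G \<le> k"
  unfolding injective_chromatic_number_def by (auto intro: Least_le)

text \<open>The least number is attained once some coloring exists, whatever its number of colors;
  \<open>f\<close> is that witness.\<close>

lemma injective_chromatic_number_attained: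
  assumes "injective_coloring G k f"
  obtains g where "injective_coloring G (injective_chromatic_number G) g"
  using that LeastI_ex[of "\<lambda>k. \<exists>f. injective_coloring G k f"] assms
  unfolding injective_chromatic_number_def by blast

lemma (in pair_graph) parcs_sym: "(u, v) \<in> parcs G \<Longrightarrow> (v, u) \<in> parcs G"
  using sym_arcs by (auto simp: symmetric_def dest: symD)

text \<open>A common neighbor of two distinct vertices in one class would, by symmetry of the arcs,
  be adjacent to two vertices of equal color.\<close>

lemma (in pair_graph) open_packing_color_class:
  assumes "injective_coloring G k f"
  shows "open_packing G {v \<in> pverts G. f v = c}"
  using assms parcs_sym unfolding open_packing_def open_nbhd_def injective_coloring_def
  by blast

lemma (in pair_graph) order_le_colors_times_open_packing_number:
  assumes "injective_coloring G k f"
  shows "order_of G \<le> k * open_packing_number G"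
proof -
  have "pverts G = (\<Union>c\<in>{1..k}. {v \<in> pverts G. f v = c})"
    using assms by (auto simp: injective_coloring_def)
  then have "order_of G \<le> (\<Sum>c\<in>{1..k}. card {v \<in> pverts G. f v = c})"
    unfolding order_of_def by (metis card_UN_le finite_atLeastAtMost)
  also have "\<dots> \<le> (\<Sum>c\<in>{1..k}. open_packing_number G)"
    using card_le_open_packing_number[OF pair_finite_verts open_packing_color_class[OF assms]]
    by (rule sum_mono)
  finally show ?thesis by simp
qed

lemma (in pair_graph) injective_coloring_of_open_packing:
  assumes "open_packing G B"
  obtains f where "injective_coloring G (order_of G - card B + 1) f"
proof -
  have sub: "B \<subseteq> pverts G" using assms by (simp add: open_packing_def)
  then have card: "card (pverts G - B) = order_of G - card B"
    by (simp add: order_of_def card_Diff_subset finite_subset)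
  obtain h where h: "bij_betw h (pverts G - B) {0..<order_of G - card B}"
    using ex_bij_betw_finite_nat[of "pverts G - B"] card by auto
  \<comment> \<open>Color 1 is shared by all of \<open>B\<close>. Since \<open>h\<close> counts from
    0, the shift by 2 gives the remaining vertices the private colors from 2 up to
    \<open>order_of G - card B + 1\<close>.\<close>
  define f where "f = (\<lambda>v. if v \<in> B then 1 else h v + 2)"
  have range: "f v \<in> {1..order_of G - card B + 1}" if "v \<in> pverts G" for v
    using that bij_betwE[OF h, rule_format, of v] by (auto simp: f_def)
  have distinct: "f u \<noteq> f w"
    if "v \<in> pverts G" "u \<in> pverts G" "w \<in> pverts G" "u \<noteq> w" "(v, u) \<in> parcs G" "(v, w) \<in> parcs G"
    for u v w
  proof (cases "u \<in> B \<and> w \<in> B")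
    case True
    \<comment> \<open>A common neighbor \<open>v\<close> of two vertices of \<open>B\<close>
      contradicts the packing property.\<close>
    have "v \<in> open_nbhd G u \<inter> open_nbhd G w"
      using that parcs_sym by (simp add: open_nbhd_def)
    with True \<open>u \<noteq> w\<close> assms show ?thesis by (auto simp: open_packing_def)
  next
    case False
    \<comment> \<open>Either exactly one vertex has color 1, or both lie outside \<open>B\<close>
      and injectivity of \<open>h\<close> separates them.\<close>
    with that bij_betw_imp_inj_on[OF h] show ?thesis
      by (auto simp: f_def inj_on_def)
  qed
  have "injective_coloring G (order_of G - card B + 1) f"
    using range distinct unfolding injective_coloring_def by blast
  with that show thesis .
qed

text \<open>Ensures that the truncated subtraction in the upper bound agrees with subtraction of
  reals.\<close>

lemma (in pair_graph) open_packing_number_le_order: "open_packing_number G \<le> order_of G"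
proof -
  obtain B where "open_packing G B" and "card B = open_packing_number G"
    using open_packing_number_attained[OF pair_finite_verts] .
  then show ?thesis
    unfolding open_packing_def order_of_def by (metis card_mono pair_finite_verts)
qed

lemma (in pair_graph) injective_chromatic_number_upper:
  "injective_chromatic_number G \<le> order_of G - open_packing_number G + 1"
  using open_packing_number_attained injective_coloring_of_open_packing
    injective_chromatic_number_le pair_finite_verts by metis

lemma (in pair_graph) injective_chromatic_number_lower:
  "order_of G \<le> injective_chromatic_number G * open_packing_number G"
  \<comment> \<open>The empty packing already yields a coloring, with \<open>order_of G + 1\<close>
    colors, so the minimum exists.\<close>
  using injective_coloring_of_open_packing[OF open_packing_empty]
    injective_chromatic_number_attained order_le_colors_times_open_packing_number by metis

lemma (in pair_graph) injective_chromatic_number_bounds: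
  "real (order_of G) / real (open_packing_number G) \<le> real (injective_chromatic_number G)"
  "real (injective_chromatic_number G) \<le> real (order_of G) - real (open_packing_number G) + 1"
proof -
  have "real (order_of G) \<le> real (injective_chromatic_number G) * real (open_packing_number G)"
    using injective_chromatic_number_lower by (metis of_nat_le_iff of_nat_mult)
  then show "real (order_of G) / real (open_packing_number G) \<le> real (injective_chromatic_number G)"
    \<comment> \<open>Packing number 0 occurs for the graph without vertices; the quotient is then 0
      by the convention for division by zero.\<close>
    by (cases "open_packing_number G = 0") (auto simp: pos_divide_le_eq)
  show "real (injective_chromatic_number G) \<le> real (order_of G) - real (open_packing_number G) + 1"
    using injective_chromatic_number_upper open_packing_number_le_order by linarith
qed

definition triangle :: "nat pair_pre_digraph" where
  "triangle = \<lparr>pverts = {..<3}, parcs = {(u, v). u < 3 \<and> v < 3 \<and> u \<noteq> v}\<rparr>"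

lemma pair_graph_triangle: "pair_graph triangle"
proof
  show "finite (parcs triangle)"
    by (rule finite_subset[of _ "{..<3} \<times> {..<3}"]) (auto simp: triangle_def)
qed (auto simp: triangle_def symmetric_def sym_def)

lemma open_packing_number_triangle: "open_packing_number triangle = 1"
proof (rule antisym)
  have fin: "finite (pverts triangle)" by (simp add: triangle_def)
  obtain B where B: "open_packing triangle B" "card B = open_packing_number triangle"
    using open_packing_number_attained[OF fin] .
  have "u = v" if "u \<in> B" "v \<in> B" for u v
  proof (rule ccontr)
    assume "u \<noteq> v"
    have "u < 3" "v < 3" using B(1) that by (auto simp: open_packing_def triangle_def)
    \<comment> \<open>The vertices 0, 1, 2 sum to 3, so \<open>3 - u - v\<close> is the third
      vertex, adjacent to both.\<close>
    with \<open>u \<noteq> v\<close> have "3 - u - v \<in> open_nbhd triangle u \<inter> open_nbhd triangle v"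
      by (auto simp: open_nbhd_def triangle_def; presburger)
    with B(1) that \<open>u \<noteq> v\<close> show False unfolding open_packing_def by blast
  qed
  then have "card B \<le> Suc 0"
    by (intro card_le_Suc0_iff_eq[THEN iffD2])
      (use B(1) fin in \<open>auto simp: open_packing_def intro: finite_subset\<close>)
  with B(2) show "open_packing_number triangle \<le> 1" by simp
  have "open_packing triangle {0}" by (simp add: open_packing_def triangle_def)
  from card_le_open_packing_number[OF fin this] show "1 \<le> open_packing_number triangle" by simp
qed

theorem proposition5:
  shows "(\<forall>G :: 'a pair_pre_digraph. \<forall>n. pair_graph G \<and> order_of G = n \<longrightarrow>
            real n / real (open_packing_number G) \<le> real (injective_chromatic_number G) \<and>
            real (injective_chromatic_number G) \<le> real n - real (open_packing_number G) + 1) \<and>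
         (\<exists>G :: nat pair_pre_digraph. pair_graph G \<and> pverts G \<noteq> {} \<and>
            real (order_of G) / real (open_packing_number G)
              = real (injective_chromatic_number G)) \<and>
         (\<exists>G :: nat pair_pre_digraph. pair_graph G \<and> pverts G \<noteq> {} \<and>
            real (injective_chromatic_number G)
              = real (order_of G) - real (open_packing_number G) + 1)"
proof (intro conjI allI impI; (elim conjE)?)
  fix G :: "'a pair_pre_digraph" and n
  assume "pair_graph G" and n: "order_of G = n"
  interpret pair_graph G by fact
  show "real n / real (open_packing_number G) \<le> real (injective_chromatic_number G)"
    and "real (injective_chromatic_number G) \<le> real n - real (open_packing_number G) + 1"
    using injective_chromatic_number_bounds n by simp_all
next
  have nonempty: "pverts triangle \<noteq> {}" by (simp add: triangle_def lessThan_empty_iff)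
  note bounds = pair_graph.injective_chromatic_number_bounds[OF pair_graph_triangle]
  show "\<exists>G :: nat pair_pre_digraph. pair_graph G \<and> pverts G \<noteq> {} \<and>
      real (order_of G) / real (open_packing_number G) = real (injective_chromatic_number G)"
    \<comment> \<open>With packing number 1 both bounds equal the order, which forces the chromatic
      number without computing it from a coloring.\<close>
    using pair_graph_triangle nonempty bounds
    by (intro exI[of _ triangle]) (simp add: open_packing_number_triangle)
  show "\<exists>G :: nat pair_pre_digraph. pair_graph G \<and> pverts G \<noteq> {} \<and>
      real (injective_chromatic_number G) = real (order_of G) - real (open_packing_number G) + 1"
    using pair_graph_triangle nonempty bounds
    by (intro exI[of _ triangle]) (simp add: open_packing_number_triangle)
qed

end
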